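(* Let $(E,E_+,\{p_\alpha\}_{\alpha\in A})$ be a calibrated ordered space with a closed cone $E_+$. Suppose that there are a locally compact Hausdorff space $X$, a family of disjoint compact subsets $\{K_\alpha\}_{\alpha\in A}$ of $X$ with $X=\bigcup_{\alpha\in A}K_\alpha$ such that any compact subset of $X$ is contained in a finite union from the family $\{K_\alpha\}_{\alpha\in A}$, and a subspace $W\subseteq C(X)$ isometrically isomorphic to $E$ (with which $E$ is identified), such that for every $\alpha\in A$ every $f\in E'_{\alpha,+}$ has a BNN extension $\tilde f\in C(X)'_{\alpha,+}$; fix such data. For a fixed $\alpha\in A$, consider two positive functionals $f,g\in E'_{\alpha,+}$. Then $|f+g|_\alpha=|f|_\alpha+|g|_\alpha$ if and only if the positive functional $f+g$ has a BNN extension $\widetilde{f+g}\in C(X)'_{\alpha,+}$ such that $\widetilde{f+g}\ge\tilde f$ for some BNN extension $\tilde f\in C(X)'_{\alpha,+}$ of $f$.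
   Context: All vector spaces are real. An ordered space $(E,E_+)$ is a vector space $E$ with a cone $E_+$: $\alpha x_1+\beta x_2\in E_+$ for $x_1,x_2\in E_+$, $\alpha,\beta\ge 0$, and $E_+\cap(-E_+)=\{0\}$; $x\le y$ means $y-x\in E_+$. A vector subspace $W$ carries the cone $W\cap E_+$. A calibrated ordered space $(E,E_+,\{p_\alpha\}_{\alpha\in A})$ is an ordered space with a locally convex topology together with a specified family of continuous seminorms generating the topology, such that $p_\alpha(x)=0$ for all $\alpha\in A$ implies $x=0$. A linear functional is positive if it is nonnegative on the cone; for linear functionals $h\ge k$ means $h-k$ is positive. $E'_\alpha$ is the space of linear $f\colon E\to\mathbb{R}$ for which there is $C\ge0$ with $|f(x)|\le Cp_\alpha(x)$ for all $x\in E$, and $|f|_\alpha$ is the infimum of such $C$. $E'_{\alpha,+}$ is the set of positive $f\in E'_\alpha$. $C(X)$ denotes the space of all continuous functions $X\to\mathbb{R}$ with the cone $C(X)_+$ of pointwise nonnegative functions and the seminorms $|u|_{K_\alpha}=\sup_{t\in K_\alpha}|u(t)|$, $\alpha\in A$; subspaces inherit the cone and the seminorms, and $C(X)'_{\alpha,+}$ and $|\cdot|_\alpha$ on it are defined with respect to $|\cdot|_{K_\alpha}$. $W$ is isometrically isomorphic to $E$ if there is a linear bijection $\phi\colon E\to W$ with $x\in E_+\iff\phi(x)\in W_+$ and $|\phi(x)|_{K_\alpha}=p_\alpha(x)$ for all $x\in E$, $\alpha\in A$. A BNN extension of $f\in E'_{\alpha,+}$ is an $\tilde f\in C(X)'_{\alpha,+}$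 with $\tilde f(\phi(x))=f(x)$ for all $x\in E$ and $|\tilde f|_\alpha=|f|_\alpha$. *)

theory Defs
  imports "HOL-Analysis.Analysis"
begin

text \<open>The vector space \<open>E\<close> is the whole type \<open>'e\<close>.\<close>

definition ordered_space_cone :: "'e::real_vector set \<Rightarrow> bool" where
  "ordered_space_cone P \<longleftrightarrow>
     (\<forall>x\<in>P. \<forall>y\<in>P. \<forall>a b. 0 \<le> a \<longrightarrow> 0 \<le> b \<longrightarrow> a *\<^sub>R x + b *\<^sub>R y \<in> P) \<and>
     P \<inter> uminus ` P = {0}"

definition seminorm :: "('e::real_vector \<Rightarrow> real) \<Rightarrow> bool" where
  "seminorm q \<longleftrightarrow>
     (\<forall>x. 0 \<le> q x) \<and> (\<forall>x y. q (x + y) \<le> q x + q y) \<and> (\<forall>c x. q (c *\<^sub>R x) = \<bar>c\<bar> * q x)"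

text \<open>The locally convex topology generated by a family of seminorms: the coarsest one in which
  all the open seminorm balls are open. \<open>UNIV\<close> is a member of the subbase so that the topology
  lives on all of \<open>E\<close> even for an empty family.\<close>

definition seminorm_topology :: "'a set \<Rightarrow> ('a \<Rightarrow> 'e::real_vector \<Rightarrow> real) \<Rightarrow> 'e topology" where
  "seminorm_topology A p =
     topology_generated_by (insert UNIV {{y. p \<alpha> (y - x) < r} |\<alpha> x r. \<alpha> \<in> A \<and> 0 < r})"

text \<open>The topology is not a separate parameter because it is determined by the seminorms,
  which are continuous for \<open>seminorm_topology A p\<close>.\<close>

definition calibrated_ordered_space ::
    "'e::real_vector set \<Rightarrow> 'a set \<Rightarrow> ('a \<Rightarrow> 'e \<Rightarrow> real) \<Rightarrow> bool" where
  "calibrated_ordered_space P A p \<longleftrightarrow>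
     ordered_space_cone P \<and>
     (\<forall>\<alpha>\<in>A. seminorm (p \<alpha>)) \<and>
     (\<forall>x. (\<forall>\<alpha>\<in>A. p \<alpha> x = 0) \<longrightarrow> x = 0)"

definition positive_on :: "'v set \<Rightarrow> ('v \<Rightarrow> real) \<Rightarrow> bool" where
  "positive_on P f \<longleftrightarrow> (\<forall>x\<in>P. 0 \<le> f x)"

definition functional_bounds :: "'v set \<Rightarrow> ('v \<Rightarrow> real) \<Rightarrow> ('v \<Rightarrow> real) \<Rightarrow> real set" where
  "functional_bounds V q f = {c. 0 \<le> c \<and> (\<forall>x\<in>V. \<bar>f x\<bar> \<le> c * q x)}"

definition functional_norm :: "'v set \<Rightarrow> ('v \<Rightarrow> real) \<Rightarrow> ('v \<Rightarrow> real) \<Rightarrow> real" where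
  "functional_norm V q f = Inf (functional_bounds V q f)"

text \<open>This is \<open>E'\<^sub>\<alpha>\<^sub>,\<^sub>+\<close> for \<open>q = p \<alpha>\<close> and \<open>P = E\<^sub>+\<close>.\<close>

definition positive_dual :: "'e::real_vector set \<Rightarrow> ('e \<Rightarrow> real) \<Rightarrow> ('e \<Rightarrow> real) set" where
  "positive_dual P q = {f. linear f \<and> functional_bounds UNIV q f \<noteq> {} \<and> positive_on P f}"

text \<open>A continuous function on \<open>X\<close> is represented by its extension by \<open>0\<close> outside
  \<open>topspace X\<close>, so that distinct representatives are distinct functions on \<open>X\<close>, and the
  vector space operations are the pointwise ones.\<close>

definition C_space :: "'x topology \<Rightarrow> ('x \<Rightarrow> real) set" where
  "C_space X = {u. continuous_map X euclideanreal u \<and> (\<forall>t. t \<notin> topspace X \<longrightarrow> u t = 0)}"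

definition C_cone :: "'x topology \<Rightarrow> ('x \<Rightarrow> real) set" where
  "C_cone X = {u \<in> C_space X. \<forall>t\<in>topspace X. 0 \<le> u t}"

text \<open>The supremum is taken in \<open>[0, \<infinity>)\<close>; inserting \<open>0\<close> matters only for empty \<open>K\<close>.\<close>

definition sup_seminorm :: "'x set \<Rightarrow> ('x \<Rightarrow> real) \<Rightarrow> real" where
  "sup_seminorm K u = Sup (insert 0 ((\<lambda>t. \<bar>u t\<bar>) ` K))"

definition C_subspace :: "'x topology \<Rightarrow> ('x \<Rightarrow> real) set \<Rightarrow> bool" where
  "C_subspace X W \<longleftrightarrow>
     W \<subseteq> C_space X \<and> (\<lambda>t. 0) \<in> W \<and>
     (\<forall>u\<in>W. \<forall>v\<in>W. \<forall>a b. (\<lambda>t. a * u t + b * v t) \<in> W)"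

text \<open>Functionals on \<open>C(X)\<close> are total functions of which only the values on \<open>C_space X\<close>
  matter.\<close>

definition C_linear :: "'x topology \<Rightarrow> (('x \<Rightarrow> real) \<Rightarrow> real) \<Rightarrow> bool" where
  "C_linear X F \<longleftrightarrow>
     (\<forall>u\<in>C_space X. \<forall>v\<in>C_space X. \<forall>a b. F (\<lambda>t. a * u t + b * v t) = a * F u + b * F v)"

definition C_positive_dual :: "'x topology \<Rightarrow> 'x set \<Rightarrow> (('x \<Rightarrow> real) \<Rightarrow> real) set" where
  "C_positive_dual X K =
     {F. C_linear X F \<and> functional_bounds (C_space X) (sup_seminorm K) F \<noteq> {} \<and>
         positive_on (C_cone X) F}"

definition isometric_isomorphism ::
    "'e::real_vector set \<Rightarrow> 'a set \<Rightarrow> ('a \<Rightarrow> 'e \<Rightarrow> real) \<Rightarrow> 'x topology \<Rightarrow> ('a \<Rightarrow> 'x set) \<Rightarrow>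
     ('x \<Rightarrow> real) set \<Rightarrow> ('e \<Rightarrow> 'x \<Rightarrow> real) \<Rightarrow> bool" where
  "isometric_isomorphism P A p X K W \<phi> \<longleftrightarrow>
     bij_betw \<phi> UNIV W \<and>
     (\<forall>x y a b. \<phi> (a *\<^sub>R x + b *\<^sub>R y) = (\<lambda>t. a * \<phi> x t + b * \<phi> y t)) \<and>
     (\<forall>x. x \<in> P \<longleftrightarrow> \<phi> x \<in> W \<inter> C_cone X) \<and>
     (\<forall>\<alpha>\<in>A. \<forall>x. sup_seminorm (K \<alpha>) (\<phi> x) = p \<alpha> x)"

definition BNN_extension ::
    "'x topology \<Rightarrow> 'x set \<Rightarrow> ('e::real_vector \<Rightarrow> 'x \<Rightarrow> real) \<Rightarrow> ('e \<Rightarrow> real) \<Rightarrow> ('e \<Rightarrow> real) \<Rightarrow>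
     (('x \<Rightarrow> real) \<Rightarrow> real) \<Rightarrow> bool" where
  "BNN_extension X K \<phi> q f F \<longleftrightarrow>
     F \<in> C_positive_dual X K \<and>
     (\<forall>x. F (\<phi> x) = f x) \<and>
     functional_norm (C_space X) (sup_seminorm K) F = functional_norm UNIV q f"

end

theory Submission
  imports Defs
begin

text \<open>
  The weight of the proof is carried by one fact: on the positive functionals of \<open>C(X)'\<^sub>\<alpha>\<close> the norm
  is evaluation at the constant function \<open>1\<close> (\<open>positive_dual_norm_eq_value_at_unit\<close>), so it is
  additive there. On \<open>E\<close>, where no such element need exist, only the triangle inequality holds in
  general; equality in it is what the extensions detect.

  If the norms of \<open>f\<close> and \<open>g\<close> add up, the sum of any two BNN extensions \<open>F\<close> and \<open>G\<close> is a positive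
  extension of \<open>f + g\<close> whose norm is \<open>F 1 + G 1\<close>, that is, the norm of \<open>f + g\<close>; it dominates \<open>F\<close>
  because the difference is \<open>G\<close>. Conversely, if \<open>H\<close> dominates \<open>F\<close>, then \<open>H - F\<close> is a positive
  extension of \<open>g\<close> with norm \<open>H 1 - F 1\<close>. As restricting a functional to the isometric copy of \<open>E\<close>
  cannot increase its norm (\<open>restriction_functional_norm_le\<close>), the norm of \<open>g\<close> is at most that
  of \<open>f + g\<close> minus that of \<open>f\<close>, which is the missing half of the equality.
\<close>

section \<open>The norm of a functional\<close>

lemma functional_norm_le:
  assumes "c \<in> functional_bounds V q f"
  shows "functional_norm V q f \<le> c"
proof -
  have "bdd_below (functional_bounds V q f)"
    by (rule bdd_belowI[of _ 0]) (auto simp: functional_bounds_def)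
  then show ?thesis
    unfolding functional_norm_def using assms by (rule cInf_lower[rotated])
qed

lemma functional_norm_in_bounds:
  assumes ne: "functional_bounds V q f \<noteq> {}" and q: "\<And>x. x \<in> V \<Longrightarrow> 0 \<le> q x"
  shows "functional_norm V q f \<in> functional_bounds V q f"
proof -
  have "0 \<le> functional_norm V q f"
    unfolding functional_norm_def
    by (rule cInf_greatest[OF ne]) (auto simp: functional_bounds_def)
  moreover have "\<bar>f x\<bar> \<le> functional_norm V q f * q x" if x: "x \<in> V" for x
  proof (cases "q x = 0")
    case True
    then show ?thesis
      using ne x by (auto simp: functional_bounds_def)
  next
    case False
    with q[OF x] have pos: "0 < q x" by simp
    have "\<bar>f x\<bar> / q x \<le> functional_norm V q f"
      unfolding functional_norm_def
      by (rule cInf_greatest[OF ne]) (use pos x in \<open>auto simp: functional_bounds_def divide_simps\<close>)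
    then show ?thesis
      using pos by (simp add: divide_simps)
  qed
  ultimately show ?thesis
    by (simp add: functional_bounds_def)
qed

lemma functional_bounds_add:
  assumes "c \<in> functional_bounds V q f" "d \<in> functional_bounds V q g"
  shows "c + d \<in> functional_bounds V q (\<lambda>x. f x + g x)"
  using assms unfolding functional_bounds_def
  by (auto simp: distrib_right intro!: order_trans[OF abs_triangle_ineq] add_mono)

lemma functional_norm_triangle:
  assumes "functional_bounds V q f \<noteq> {}" "functional_bounds V q g \<noteq> {}"
    and "\<And>x. x \<in> V \<Longrightarrow> 0 \<le> q x"
  shows "functional_norm V q (\<lambda>x. f x + g x) \<le> functional_norm V q f + functional_norm V q g"
  using assms by (intro functional_norm_le functional_bounds_add functional_norm_in_bounds)

section \<open>The seminorm of a compact set\<close>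

lemma bdd_above_abs_on_compactin:
  assumes "compactin X K" "u \<in> C_space X"
  shows "bdd_above (insert 0 ((\<lambda>t. \<bar>u t\<bar>) ` K))"
proof -
  have "compactin euclideanreal (u ` K)"
    using assms unfolding C_space_def by (blast intro: image_compactin)
  then have "bounded (u ` K)"
    by (simp add: compact_imp_bounded)
  then obtain b where "0 < b" "\<forall>t\<in>K. \<bar>u t\<bar> \<le> b"
    by (auto simp: bounded_pos)
  then show ?thesis
    by (intro bdd_aboveI[of _ b]) auto
qed

lemma abs_le_sup_seminorm:
  assumes "compactin X K" "u \<in> C_space X" "t \<in> K"
  shows "\<bar>u t\<bar> \<le> sup_seminorm K u"
  unfolding sup_seminorm_def
  by (rule cSup_upper) (use assms bdd_above_abs_on_compactin in auto)

lemma sup_seminorm_nonneg: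
  assumes "compactin X K" "u \<in> C_space X"
  shows "0 \<le> sup_seminorm K u"
  unfolding sup_seminorm_def
  by (rule cSup_upper) (use assms bdd_above_abs_on_compactin in auto)

lemma sup_seminorm_le:
  assumes "0 \<le> c" "\<And>t. t \<in> K \<Longrightarrow> \<bar>u t\<bar> \<le> c"
  shows "sup_seminorm K u \<le> c"
  unfolding sup_seminorm_def by (rule cSup_least) (use assms in auto)

section \<open>Positive functionals on continuous functions\<close>

text \<open>The values outside \<open>topspace X\<close> are \<open>0\<close> because members of \<open>C_space X\<close> vanish there.\<close>

definition C_unit :: "'x topology \<Rightarrow> 'x \<Rightarrow> real" where
  "C_unit X t = (if t \<in> topspace X then 1 else 0)"

lemma C_unit_in_C_cone: "C_unit X \<in> C_cone X"
proof -
  have "continuous_map X euclideanreal (C_unit X)"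
    by (rule continuous_map_eq[of _ _ "\<lambda>_. 1"]) (auto simp: C_unit_def)
  then show ?thesis
    by (auto simp: C_cone_def C_space_def C_unit_def)
qed

lemma C_unit_in_C_space: "C_unit X \<in> C_space X"
  using C_unit_in_C_cone by (auto simp: C_cone_def)

lemma C_space_linear_combination:
  assumes "u \<in> C_space X" "v \<in> C_space X"
  shows "(\<lambda>t. a * u t + b * v t) \<in> C_space X"
  using assms by (auto simp: C_space_def intro!: continuous_intros)

lemma C_space_truncation:
  assumes "u \<in> C_space X" "0 \<le> s"
  shows "(\<lambda>t. max (- s) (min s (u t))) \<in> C_space X"
  using assms by (auto simp: C_space_def intro!: continuous_map_real_max continuous_map_real_min)

text \<open>A functional bounded by the seminorm of \<open>K\<close> does not see what a function does off \<open>K\<close>.\<close>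

lemma functional_eq_if_eq_on_compact:
  assumes F: "F \<in> C_positive_dual X K"
    and u: "u \<in> C_space X" and v: "v \<in> C_space X" and eq: "\<And>t. t \<in> K \<Longrightarrow> u t = v t"
  shows "F u = F v"
proof -
  define w where "w = (\<lambda>t. 1 * u t + (- 1) * v t)"
  have w: "w \<in> C_space X"
    unfolding w_def using u v by (rule C_space_linear_combination)
  obtain c where c: "0 \<le> c" "\<And>z. z \<in> C_space X \<Longrightarrow> \<bar>F z\<bar> \<le> c * sup_seminorm K z"
    using F by (auto simp: C_positive_dual_def functional_bounds_def)
  have "sup_seminorm K w \<le> 0"
    by (rule sup_seminorm_le) (auto simp: w_def eq)
  then have "\<bar>F w\<bar> \<le> 0"
    using c(2)[OF w] mult_nonneg_nonpos[OF c(1)] by fastforce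
  moreover have "F w = 1 * F u + (- 1) * F v"
    using F u v unfolding w_def C_positive_dual_def C_linear_def by blast
  ultimately show ?thesis by simp
qed

lemma positive_functional_mono:
  assumes F: "F \<in> C_positive_dual X K"
    and u: "u \<in> C_space X" and v: "v \<in> C_space X"
    and le: "\<And>t. t \<in> topspace X \<Longrightarrow> a * u t \<le> b * v t"
  shows "a * F u \<le> b * F v"
proof -
  have "(\<lambda>t. b * v t + (- a) * u t) \<in> C_cone X"
    using C_space_linear_combination[OF v u, of b "- a"] le by (auto simp: C_cone_def)
  then have "0 \<le> F (\<lambda>t. b * v t + (- a) * u t)"
    using F by (auto simp: C_positive_dual_def positive_on_def)
  also have "\<dots> = b * F v + (- a) * F u"
    using F u v unfolding C_positive_dual_def C_linear_def by blast
  finally show ?thesis by simp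
qed

text \<open>As for positive functionals on the continuous functions of a compact space, except that here
  a bound of \<open>\<bar>u\<bar>\<close> on \<open>K\<close> need not hold on \<open>X\<close>. Truncating \<open>u\<close> at its seminorm makes it hold
  without changing the value of the functional.\<close>

lemma positive_dual_norm_eq_value_at_unit:
  assumes K: "compactin X K" and F: "F \<in> C_positive_dual X K"
  shows "functional_norm (C_space X) (sup_seminorm K) F = F (C_unit X)"
proof (rule antisym)
  have unit_nonneg: "0 \<le> F (C_unit X)"
    using F C_unit_in_C_cone by (auto simp: C_positive_dual_def positive_on_def)
  have "\<bar>F u\<bar> \<le> F (C_unit X) * sup_seminorm K u" if u: "u \<in> C_space X" for u
  proof -
    define s where "s = sup_seminorm K u"
    define v where "v = (\<lambda>t. max (- s) (min s (u t)))"
    have s: "0 \<le> s"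
      unfolding s_def using K u by (rule sup_seminorm_nonneg)
    have v: "v \<in> C_space X"
      unfolding v_def using u s by (rule C_space_truncation)
    have "F u = F v"
    proof (rule functional_eq_if_eq_on_compact[OF F u v])
      fix t assume "t \<in> K"
      then have "\<bar>u t\<bar> \<le> s"
        unfolding s_def by (rule abs_le_sup_seminorm[OF K u])
      then show "u t = v t"
        by (auto simp: v_def)
    qed
    moreover have "1 * F v \<le> s * F (C_unit X)"
      by (rule positive_functional_mono[OF F v C_unit_in_C_space])
        (use s in \<open>auto simp: v_def C_unit_def\<close>)
    moreover have "(- s) * F (C_unit X) \<le> 1 * F v"
      by (rule positive_functional_mono[OF F C_unit_in_C_space v])
        (use s in \<open>auto simp: v_def C_unit_def\<close>)
    ultimately show ?thesis
      by (simp add: s_def abs_le_iff mult.commute)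
  qed
  then show "functional_norm (C_space X) (sup_seminorm K) F \<le> F (C_unit X)"
    using unit_nonneg by (intro functional_norm_le) (simp add: functional_bounds_def)
next
  have "functional_norm (C_space X) (sup_seminorm K) F
          \<in> functional_bounds (C_space X) (sup_seminorm K) F"
    using F K by (intro functional_norm_in_bounds)
      (auto simp: C_positive_dual_def intro: sup_seminorm_nonneg)
  then have norm: "0 \<le> functional_norm (C_space X) (sup_seminorm K) F"
    "\<bar>F (C_unit X)\<bar> \<le> functional_norm (C_space X) (sup_seminorm K) F * sup_seminorm K (C_unit X)"
    using C_unit_in_C_space by (auto simp: functional_bounds_def)
  have "sup_seminorm K (C_unit X) \<le> 1"
    by (rule sup_seminorm_le) (auto simp: C_unit_def)
  then have "functional_norm (C_space X) (sup_seminorm K) F * sup_seminorm K (C_unit X)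
               \<le> functional_norm (C_space X) (sup_seminorm K) F"
    using norm(1) by (rule mult_left_le)
  with norm(2) show "F (C_unit X) \<le> functional_norm (C_space X) (sup_seminorm K) F"
    by linarith
qed

lemma C_linear_add:
  assumes "C_linear X F" "C_linear X G"
  shows "C_linear X (\<lambda>u. F u + G u)"
  using assms unfolding C_linear_def by (simp add: algebra_simps)

lemma C_linear_diff:
  assumes "C_linear X F" "C_linear X G"
  shows "C_linear X (\<lambda>u. F u - G u)"
  using assms unfolding C_linear_def by (simp add: algebra_simps)

lemma C_positive_dual_add:
  assumes "F \<in> C_positive_dual X K" "G \<in> C_positive_dual X K"
  shows "(\<lambda>u. F u + G u) \<in> C_positive_dual X K"
proof -
  have "functional_bounds (C_space X) (sup_seminorm K) (\<lambda>u. F u + G u) \<noteq> {}"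
    using assms functional_bounds_add[of _ "C_space X" "sup_seminorm K" F _ G]
    by (auto simp: C_positive_dual_def)
  then show ?thesis
    using assms by (auto simp: C_positive_dual_def positive_on_def C_linear_add)
qed

lemma C_positive_dual_diff:
  assumes "H \<in> C_positive_dual X K" "F \<in> C_positive_dual X K"
    and "positive_on (C_cone X) (\<lambda>u. H u - F u)"
  shows "(\<lambda>u. H u - F u) \<in> C_positive_dual X K"
proof -
  have "functional_bounds (C_space X) (sup_seminorm K) (\<lambda>u. - F u)
          = functional_bounds (C_space X) (sup_seminorm K) F"
    by (simp add: functional_bounds_def)
  then have "functional_bounds (C_space X) (sup_seminorm K) (\<lambda>u. H u - F u) \<noteq> {}"
    using assms functional_bounds_add[of _ "C_space X" "sup_seminorm K" H _ "\<lambda>u. - F u"]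
    by (auto simp: C_positive_dual_def)
  then show ?thesis
    using assms by (simp add: C_positive_dual_def C_linear_diff)
qed

section \<open>Additivity of the norm and dominating extensions\<close>

lemma BNN_extension_value_at_unit:
  assumes "compactin X K" "BNN_extension X K \<phi> q f F"
  shows "F (C_unit X) = functional_norm UNIV q f"
  using assms positive_dual_norm_eq_value_at_unit unfolding BNN_extension_def by metis

lemma restriction_functional_norm_le:
  assumes K: "compactin X K" and G: "G \<in> C_positive_dual X K"
    and \<phi>: "\<And>x. \<phi> x \<in> C_space X" "\<And>x. sup_seminorm K (\<phi> x) = q x"
    and ext: "\<And>x. G (\<phi> x) = g x"
  shows "functional_norm UNIV q g \<le> functional_norm (C_space X) (sup_seminorm K) G"
proof (rule functional_norm_le)
  have "functional_norm (C_space X) (sup_seminorm K) G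
          \<in> functional_bounds (C_space X) (sup_seminorm K) G"
    using G K by (intro functional_norm_in_bounds)
      (auto simp: C_positive_dual_def intro: sup_seminorm_nonneg)
  then show "functional_norm (C_space X) (sup_seminorm K) G \<in> functional_bounds UNIV q g"
    unfolding functional_bounds_def using \<phi> ext by force
qed

theorem theorem5p2:
  fixes P :: "'e::real_vector set"
    and A :: "'a set"
    and p :: "'a \<Rightarrow> 'e \<Rightarrow> real"
    and X :: "'x topology"
    and K :: "'a \<Rightarrow> 'x set"
    and W :: "('x \<Rightarrow> real) set"
    and \<phi> :: "'e \<Rightarrow> 'x \<Rightarrow> real"
    and \<alpha> :: 'a
    and f g :: "'e \<Rightarrow> real"
  assumes "calibrated_ordered_space P A p"
    and "closedin (seminorm_topology A p) P"
    and "locally_compact_space X"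
    and "Hausdorff_space X"
    and "\<forall>\<beta>\<in>A. compactin X (K \<beta>)"
    and "disjoint_family_on K A"
    and "topspace X = (\<Union>\<beta>\<in>A. K \<beta>)"
    and "\<forall>S. compactin X S \<longrightarrow> (\<exists>B\<subseteq>A. finite B \<and> S \<subseteq> (\<Union>\<beta>\<in>B. K \<beta>))"
    and "C_subspace X W"
    and "isometric_isomorphism P A p X K W \<phi>"
    and "\<forall>\<beta>\<in>A. \<forall>h\<in>positive_dual P (p \<beta>). \<exists>H. BNN_extension X (K \<beta>) \<phi> (p \<beta>) h H"
    and "\<alpha> \<in> A"
    and "f \<in> positive_dual P (p \<alpha>)"
    and "g \<in> positive_dual P (p \<alpha>)"
  shows "functional_norm UNIV (p \<alpha>) (\<lambda>x. f x + g x) =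
           functional_norm UNIV (p \<alpha>) f + functional_norm UNIV (p \<alpha>) g \<longleftrightarrow>
         (\<exists>H. BNN_extension X (K \<alpha>) \<phi> (p \<alpha>) (\<lambda>x. f x + g x) H \<and>
              (\<exists>F. BNN_extension X (K \<alpha>) \<phi> (p \<alpha>) f F \<and>
                   positive_on (C_cone X) (\<lambda>u. H u - F u)))"
proof -
  have K: "compactin X (K \<alpha>)"
    using assms(5) \<open>\<alpha> \<in> A\<close> by blast
  have extends: "\<exists>F. BNN_extension X (K \<alpha>) \<phi> (p \<alpha>) h F" if "h \<in> positive_dual P (p \<alpha>)" for h
    using assms(11) \<open>\<alpha> \<in> A\<close> that by blast
  have \<phi>_C: "\<phi> x \<in> C_space X" for x
    using \<open>isometric_isomorphism P A p X K W \<phi>\<close> \<open>C_subspace X W\<close>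
    unfolding isometric_isomorphism_def C_subspace_def by (auto dest!: bij_betwE)
  have \<phi>_iso: "sup_seminorm (K \<alpha>) (\<phi> x) = p \<alpha> x" for x
    using \<open>isometric_isomorphism P A p X K W \<phi>\<close> \<open>\<alpha> \<in> A\<close>
    unfolding isometric_isomorphism_def by blast
  have p: "0 \<le> p \<alpha> x" for x
    using \<phi>_C sup_seminorm_nonneg[OF K] by (metis \<phi>_iso)
  show ?thesis
  proof
    assume norms: "functional_norm UNIV (p \<alpha>) (\<lambda>x. f x + g x) =
      functional_norm UNIV (p \<alpha>) f + functional_norm UNIV (p \<alpha>) g"
    obtain F where F: "BNN_extension X (K \<alpha>) \<phi> (p \<alpha>) f F"
      using extends \<open>f \<in> positive_dual P (p \<alpha>)\<close> by blast
    obtain G where G: "BNN_extension X (K \<alpha>) \<phi> (p \<alpha>) g G"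
      using extends \<open>g \<in> positive_dual P (p \<alpha>)\<close> by blast
    define H where "H = (\<lambda>u. F u + G u)"
    have H: "H \<in> C_positive_dual X (K \<alpha>)"
      using F G unfolding H_def BNN_extension_def by (blast intro: C_positive_dual_add)
    have "functional_norm (C_space X) (sup_seminorm (K \<alpha>)) H
            = functional_norm UNIV (p \<alpha>) (\<lambda>x. f x + g x)"
      unfolding positive_dual_norm_eq_value_at_unit[OF K H] norms
      by (simp add: H_def BNN_extension_value_at_unit[OF K F] BNN_extension_value_at_unit[OF K G])
    with F G H have "BNN_extension X (K \<alpha>) \<phi> (p \<alpha>) (\<lambda>x. f x + g x) H"
      by (simp add: BNN_extension_def H_def)
    moreover have "positive_on (C_cone X) (\<lambda>u. H u - F u)"
      using G by (simp add: H_def BNN_extension_def C_positive_dual_def)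
    ultimately show "\<exists>H. BNN_extension X (K \<alpha>) \<phi> (p \<alpha>) (\<lambda>x. f x + g x) H \<and>
      (\<exists>F. BNN_extension X (K \<alpha>) \<phi> (p \<alpha>) f F \<and> positive_on (C_cone X) (\<lambda>u. H u - F u))"
      using F by blast
  next
    assume "\<exists>H. BNN_extension X (K \<alpha>) \<phi> (p \<alpha>) (\<lambda>x. f x + g x) H \<and>
      (\<exists>F. BNN_extension X (K \<alpha>) \<phi> (p \<alpha>) f F \<and> positive_on (C_cone X) (\<lambda>u. H u - F u))"
    then obtain H F where H: "BNN_extension X (K \<alpha>) \<phi> (p \<alpha>) (\<lambda>x. f x + g x) H"
      and F: "BNN_extension X (K \<alpha>) \<phi> (p \<alpha>) f F"
      and ge: "positive_on (C_cone X) (\<lambda>u. H u - F u)"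
      by blast
    have G: "(\<lambda>u. H u - F u) \<in> C_positive_dual X (K \<alpha>)"
      using H F ge unfolding BNN_extension_def by (blast intro: C_positive_dual_diff)
    have "functional_norm UNIV (p \<alpha>) g
            \<le> functional_norm (C_space X) (sup_seminorm (K \<alpha>)) (\<lambda>u. H u - F u)"
      by (rule restriction_functional_norm_le[OF K G \<phi>_C \<phi>_iso])
        (use H F in \<open>simp add: BNN_extension_def\<close>)
    also have "\<dots> = functional_norm UNIV (p \<alpha>) (\<lambda>x. f x + g x) - functional_norm UNIV (p \<alpha>) f"
      unfolding positive_dual_norm_eq_value_at_unit[OF K G]
      by (simp add: BNN_extension_value_at_unit[OF K H] BNN_extension_value_at_unit[OF K F])
    finally have "functional_norm UNIV (p \<alpha>) f + functional_norm UNIV (p \<alpha>) g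
                    \<le> functional_norm UNIV (p \<alpha>) (\<lambda>x. f x + g x)"
      by simp
    moreover have "functional_norm UNIV (p \<alpha>) (\<lambda>x. f x + g x)
                     \<le> functional_norm UNIV (p \<alpha>) f + functional_norm UNIV (p \<alpha>) g"
      using assms(13,14) p by (intro functional_norm_triangle) (auto simp: positive_dual_def)
    ultimately show "functional_norm UNIV (p \<alpha>) (\<lambda>x. f x + g x) =
      functional_norm UNIV (p \<alpha>) f + functional_norm UNIV (p \<alpha>) g"
      by simp
  qed
qed

end
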